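(* Let $n\ge1$ and let $\Omega\subseteq\mathbb{R}^n$ be a bounded or unbounded domain. Suppose $f\in\exp^{L}(\Omega)$ and $g\in L\ln L(\Omega)$. Then $fg\in L^1(\Omega)$ and $$\int_{\Omega}|f(x)g(x)|\,dx\le\int_{\Omega}\left(e^{|f(x)|}-|f(x)|-1\right)dx+\int_{\Omega}|g(x)|\ln\left(|g(x)|+1\right)dx.$$
   Context: $\exp^{L}(\Omega):=\left\{f:\Omega\to\mathbb{C}\ \text{measurable}:\ \int_{\Omega}\left(e^{|f(x)|}-|f(x)|-1\right)dx<+\infty\right\}$ and $L\ln L(\Omega):=\left\{g:\Omega\to\mathbb{C}\ \text{measurable}:\ \int_{\Omega}|g(x)|\ln\left(|g(x)|+1\right)dx<+\infty\right\}$. *)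

theory Defs
  imports "HOL-Analysis.Analysis"
begin

text \<open>A function \<open>\<Omega> \<rightarrow> \<complex>\<close> is a total function on the ambient space whose values outside
  \<open>\<Omega>\<close> are irrelevant; measurability and integrals refer to Lebesgue measure restricted
  to \<open>\<Omega>\<close>. Both integrands below are nonnegative, as \<open>e\<^sup>t \<ge> 1 + t\<close> and \<open>ln (t + 1) \<ge> 0\<close> for
  \<open>t \<ge> 0\<close>, so the coercion \<^const>\<open>ennreal\<close> truncates nothing.\<close>

definition exp_L :: "'a::euclidean_space set \<Rightarrow> ('a \<Rightarrow> complex) set" where
  "exp_L \<Omega> =
    {f \<in> borel_measurable (lebesgue_on \<Omega>).
      (\<integral>\<^sup>+x. ennreal (exp (cmod (f x)) - cmod (f x) - 1) \<partial>lebesgue_on \<Omega>) < \<infinity>}"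

definition L_ln_L :: "'a::euclidean_space set \<Rightarrow> ('a \<Rightarrow> complex) set" where
  "L_ln_L \<Omega> =
    {g \<in> borel_measurable (lebesgue_on \<Omega>).
      (\<integral>\<^sup>+x. ennreal (cmod (g x) * ln (cmod (g x) + 1)) \<partial>lebesgue_on \<Omega>) < \<infinity>}"

end

theory Submission
  imports Defs
begin

text \<open>The functions \<open>e\<^sup>s - s - 1\<close> and \<open>(t + 1) ln (t + 1) - t\<close> are convex conjugates on the half-line
  \<open>[0, \<infinity>)\<close>, so Young's inequality bounds \<open>s t\<close> by their sum. Since \<open>ln (t + 1) \<le> t\<close>, the second
  function is at most \<open>t ln (t + 1)\<close>. With \<open>s = |f(x)|\<close> and \<open>t = |g(x)|\<close> this is the claimed
  inequality between integrands, and integrating it gives both the estimate and the integrability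
  of the product.\<close>

text \<open>The tangent of \<open>exp\<close> at \<open>u = ln (t + 1)\<close>, the point where \<open>e\<^sup>u - 1 = t\<close>, lies below the graph,
  so \<open>(t + 1) (1 + s - u) \<le> e\<^sup>s\<close>. Expanding the product leaves the excess \<open>u - t \<le> 0\<close>.\<close>

lemma Young_exp_ln:
  fixes s t :: real
  assumes "0 \<le> t"
  shows "s * t \<le> (exp s - s - 1) + t * ln (t + 1)"
proof -
  define u where "u = ln (t + 1)"
  have exp_u: "exp u = t + 1" and "u \<le> t"
    using assms ln_le_minus_one[of "t + 1"] by (auto simp: u_def)
  have "(t + 1) * (1 + (s - u)) \<le> (t + 1) * exp (s - u)"
    using assms by (intro mult_left_mono exp_ge_add_one_self) auto
  also have "\<dots> = exp s"
    by (simp flip: exp_u exp_add)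
  finally have "(t + 1) * (1 + (s - u)) \<le> exp s" .
  with \<open>u \<le> t\<close> show ?thesis
    unfolding u_def [symmetric] by (simp add: algebra_simps)
qed

lemma nn_integral_norm_mult_le_exp_ln:
  fixes f g :: "'a \<Rightarrow> 'b::{real_normed_div_algebra, second_countable_topology}"
  assumes [measurable]: "f \<in> borel_measurable M" "g \<in> borel_measurable M"
  shows "(\<integral>\<^sup>+x. ennreal (norm (f x * g x)) \<partial>M)
      \<le> (\<integral>\<^sup>+x. ennreal (exp (norm (f x)) - norm (f x) - 1) \<partial>M)
        + (\<integral>\<^sup>+x. ennreal (norm (g x) * ln (norm (g x) + 1)) \<partial>M)"
proof -
  have exp_nonneg: "0 \<le> exp s - s - 1" for s :: real
    using exp_ge_add_one_self[of s] by linarith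
  have "(\<integral>\<^sup>+x. ennreal (norm (f x * g x)) \<partial>M)
      \<le> (\<integral>\<^sup>+x. ennreal (exp (norm (f x)) - norm (f x) - 1)
            + ennreal (norm (g x) * ln (norm (g x) + 1)) \<partial>M)"
    by (intro nn_integral_mono, subst ennreal_plus [symmetric])
      (auto intro!: exp_nonneg ennreal_leI simp: norm_mult Young_exp_ln simp del: diff_ge_0_iff_ge)
  also have "\<dots> = (\<integral>\<^sup>+x. ennreal (exp (norm (f x)) - norm (f x) - 1) \<partial>M)
        + (\<integral>\<^sup>+x. ennreal (norm (g x) * ln (norm (g x) + 1)) \<partial>M)"
    by (intro nn_integral_add) measurable
  finally show ?thesis .
qed

theorem lemma2p6:
  fixes \<Omega> :: "(real ^ 'n) set"
    and f g :: "real ^ 'n \<Rightarrow> complex"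
  assumes "open \<Omega>" and "connected \<Omega>" and "\<Omega> \<noteq> {}"
    and "f \<in> exp_L \<Omega>" and "g \<in> L_ln_L \<Omega>"
  shows "integrable (lebesgue_on \<Omega>) (\<lambda>x. f x * g x) \<and>
    (\<integral>\<^sup>+x. ennreal (cmod (f x * g x)) \<partial>lebesgue_on \<Omega>)
      \<le> (\<integral>\<^sup>+x. ennreal (exp (cmod (f x)) - cmod (f x) - 1) \<partial>lebesgue_on \<Omega>)
        + (\<integral>\<^sup>+x. ennreal (cmod (g x) * ln (cmod (g x) + 1)) \<partial>lebesgue_on \<Omega>)"
proof -
  have [measurable]: "f \<in> borel_measurable (lebesgue_on \<Omega>)" "g \<in> borel_measurable (lebesgue_on \<Omega>)"
    and finite_f: "(\<integral>\<^sup>+x. ennreal (exp (cmod (f x)) - cmod (f x) - 1) \<partial>lebesgue_on \<Omega>) < \<infinity>"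
    and finite_g: "(\<integral>\<^sup>+x. ennreal (cmod (g x) * ln (cmod (g x) + 1)) \<partial>lebesgue_on \<Omega>) < \<infinity>"
    using assms by (auto simp: exp_L_def L_ln_L_def)
  have le: "(\<integral>\<^sup>+x. ennreal (cmod (f x * g x)) \<partial>lebesgue_on \<Omega>)
      \<le> (\<integral>\<^sup>+x. ennreal (exp (cmod (f x)) - cmod (f x) - 1) \<partial>lebesgue_on \<Omega>)
        + (\<integral>\<^sup>+x. ennreal (cmod (g x) * ln (cmod (g x) + 1)) \<partial>lebesgue_on \<Omega>)"
    by (intro nn_integral_norm_mult_le_exp_ln) measurable
  also have "\<dots> < \<infinity>"
    using finite_f finite_g by simp
  finally have "integrable (lebesgue_on \<Omega>) (\<lambda>x. f x * g x)"
    by (intro integrableI_bounded) measurable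
  with le show ?thesis
    by blast
qed

end
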